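(* Let $n\ge 2$ and let $V$ be a finite-dimensional calibrated representation of $A_n$, and write all generators as matrices with respect to a basis of $V$ in which $Y_1,\dots,Y_n$ are all diagonal. Suppose that for all $i=1,\dots,n-1$ and all $1\le \ell\ne m\le\dim V$, $(e_i)_{\ell,m}\ne 0$ if and only if $(s_i)_{\ell,m}\ne 0$. Then for all $1\le j\le n-1$ and $1\le m\le \dim V$, $$(Y_{j+1})_{m,m}=(Y_j)_{m,m}+(s_j)_{m,m}=(Y_j)_{m,m}\pm 1,$$ and we have the closed formula $$(Y_{j+1})_{m,m}=\sum_{a=1}^j (s_a)_{m,m}=\sum_{a=1}^j\epsilon_a,$$ where $\epsilon_a=(s_a)_{m,m}\in\{\pm1\}$ for each $a=1,\dots,j$.
   Context: The periplectic Brauer algebra $A_n$ is the unital associative $\mathbb{C}$-algebra with generators $s_i,e_i$ ($1\le i\le n-1$) and relations (for all indices for which the expressions make sense): $s_i^2=1$; $s_is_j=s_js_i$, $s_ie_j=e_js_i$, $e_ie_j=e_je_i$ if $|i-j|>1$; $s_is_{i+1}s_i=s_{i+1}s_is_{i+1}$; $e_{i+1}e_ie_{i+1}=-e_{i+1}$; $e_ie_{i+1}e_i=-e_i$; $e_is_i=e_i$; $s_ie_i=-e_i$; $s_ie_{i+1}e_i=s_{i+1}e_i$; $s_{i+1}e_ie_{i+1}=-s_ie_{i+1}$; $e_{i+1}e_is_{i+1}=e_{i+1}s_i$; $e_ie_{i+1}s_i=-e_is_{i+1}$; $e_i^2=0$. The Jucys--Murphy elements of $A_n$ are $Y_1:=0$,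 $Y_{j+1}:=s_jY_js_j+s_j+e_j$ for $1\le j\le n-1$. It is known that they commute with each other, and that they also satisfy $e_iY_j=Y_je_i$, $s_iY_j=Y_js_i$ for $j\ne i,i+1$, $e_i(Y_i-Y_{i+1})=-e_i$ and $(Y_i-Y_{i+1})e_i=e_i$. A representation $V$ of $A_n$ is called calibrated if $V$ has a basis with respect to which $Y_j$ acts by a diagonal matrix for all $j=1,\dots,n$ simultaneously. For a generator $X$, $(X)_{\ell,m}$ denotes the $(\ell,m)$ entry of the matrix by which $X$ acts. All representations are finite-dimensional over $\mathbb{C}$. *)

theory Defs
  imports Complex_Main "HOL-Library.Poly_Mapping" "HOL-Algebra.QuotRing" "HOL-Algebra.Module"
begin

section \<open>Free associative algebras and their quotients\<close>

text \<open>Words form the free monoid. They are written additively because the convolution product of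
  \<^typ>\<open>'k \<Rightarrow>\<^sub>0 'c\<close> is indexed by an additive (here non-commutative) monoid of keys.\<close>

datatype 'g fword = Word (letters: "'g list")

instantiation fword :: (type) monoid_add
begin

definition zero_fword_def: "0 = Word []"
definition plus_fword_def: "u + v = Word (letters u @ letters v)"

instance
  by standard (simp_all add: zero_fword_def plus_fword_def)

end

type_synonym 'g fpoly = "'g fword \<Rightarrow>\<^sub>0 complex"

definition letter :: "'g \<Rightarrow> 'g fpoly" where
  "letter g = Poly_Mapping.single (Word [g]) 1"

definition free_algebra :: "'g set \<Rightarrow> (complex, 'g fpoly) module" where
  "free_algebra X =
    \<lparr>carrier = {p. \<forall>w \<in> Poly_Mapping.keys p. set (letters w) \<subseteq> X},
     mult = (*), one = 1, zero = 0, add = (+),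
     smult = (\<lambda>c p. Poly_Mapping.single 0 c * p)\<rparr>"

text \<open>The ring \<^term>\<open>A Quot I\<close> together with the induced scalar multiplication
  \<open>c (I + a) = I + c a\<close>.\<close>

definition quotient_algebra :: "('c, 'a) module \<Rightarrow> 'a set \<Rightarrow> ('c, 'a set) module" where
  "quotient_algebra A I =
    \<lparr>carrier = carrier (A Quot I), mult = mult (A Quot I), one = one (A Quot I),
     zero = zero (A Quot I), add = add (A Quot I),
     smult = (\<lambda>c X. \<Union>a\<in>X. I +>\<^bsub>A\<^esub> (c \<odot>\<^bsub>A\<^esub> a))\<rparr>"

text \<open>\<^const>\<open>genideal\<close> yields two-sided ideals.\<close>

definition relation_ideal :: "'g set \<Rightarrow> ('g fpoly \<times> 'g fpoly) set \<Rightarrow> 'g fpoly set" where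
  "relation_ideal X R = Idl\<^bsub>free_algebra X\<^esub> {l - r | l r. (l, r) \<in> R}"

definition presented_algebra ::
    "'g set \<Rightarrow> ('g fpoly \<times> 'g fpoly) set \<Rightarrow> (complex, 'g fpoly set) module" where
  "presented_algebra X R = quotient_algebra (free_algebra X) (relation_ideal X R)"

lemma free_algebra_ops [simp]:
  "mult (free_algebra X) = (*)" "one (free_algebra X) = 1" "zero (free_algebra X) = 0"
  "add (free_algebra X) = (+)" "smult (free_algebra X) c p = Poly_Mapping.single 0 c * p"
  by (simp_all add: free_algebra_def)

lemma free_algebra_carrier:
  "p \<in> carrier (free_algebra X) \<longleftrightarrow> Poly_Mapping.keys p \<subseteq> {w. set (letters w) \<subseteq> X}"
  by (auto simp: free_algebra_def)

lemma free_algebra_letter [simp]: "letter g \<in> carrier (free_algebra X) \<longleftrightarrow> g \<in> X"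
  by (simp add: free_algebra_carrier letter_def)

lemma free_algebra_single_zero [simp]: "Poly_Mapping.single 0 c \<in> carrier (free_algebra X)"
  by (simp add: free_algebra_carrier zero_fword_def)

lemma free_algebra_zero [simp]: "0 \<in> carrier (free_algebra X)"
  by (simp add: free_algebra_carrier)

lemma free_algebra_one [simp]: "1 \<in> carrier (free_algebra X)"
  using free_algebra_single_zero[of 1 X] by simp

lemma free_algebra_add [simp]:
  assumes "p \<in> carrier (free_algebra X)" "q \<in> carrier (free_algebra X)"
  shows "p + q \<in> carrier (free_algebra X)"
  using assms Poly_Mapping.keys_add[of p q] unfolding free_algebra_carrier by blast

lemma free_algebra_uminus [simp]:
  assumes "p \<in> carrier (free_algebra X)"
  shows "- p \<in> carrier (free_algebra X)"
proof -
  have "Poly_Mapping.keys (- p) = Poly_Mapping.keys p"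
    by (auto simp: in_keys_iff)
  then show ?thesis using assms unfolding free_algebra_carrier by simp
qed

lemma free_algebra_diff [simp]:
  assumes "p \<in> carrier (free_algebra X)" "q \<in> carrier (free_algebra X)"
  shows "p - q \<in> carrier (free_algebra X)"
  using free_algebra_add[OF assms(1) free_algebra_uminus[OF assms(2)]] by simp

lemma free_algebra_mult [simp]:
  assumes "p \<in> carrier (free_algebra X)" "q \<in> carrier (free_algebra X)"
  shows "p * q \<in> carrier (free_algebra X)"
  unfolding free_algebra_carrier
proof
  fix w assume "w \<in> Poly_Mapping.keys (p * q)"
  then obtain u v where "u \<in> Poly_Mapping.keys p" "v \<in> Poly_Mapping.keys q" "w = u + v"
    using keys_mult[of p q] by blast
  moreover have "set (letters u) \<subseteq> X" "set (letters v) \<subseteq> X"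
    using calculation assms unfolding free_algebra_carrier by blast+
  ultimately show "w \<in> {w. set (letters w) \<subseteq> X}"
    by (simp add: plus_fword_def)
qed

lemma ring_free_algebra: "ring (free_algebra X)"
proof (rule ringI)
  show "abelian_group (free_algebra X)"
  proof (rule abelian_groupI)
    fix x assume "x \<in> carrier (free_algebra X)"
    then show "\<exists>y\<in>carrier (free_algebra X). y \<oplus>\<^bsub>free_algebra X\<^esub> x = \<zero>\<^bsub>free_algebra X\<^esub>"
      by (intro bexI[of _ "- x"]) simp_all
  qed (simp_all add: add.assoc add.commute)
  show "monoid (free_algebra X)"
    by (rule monoidI) (simp_all add: mult.assoc)
qed (simp_all add: algebra_simps)

lemma quotient_algebra_ops [simp]:
  "carrier (quotient_algebra A I) = carrier (A Quot I)"
  "mult (quotient_algebra A I) = mult (A Quot I)"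
  "one (quotient_algebra A I) = one (A Quot I)"
  "zero (quotient_algebra A I) = zero (A Quot I)"
  "add (quotient_algebra A I) = add (A Quot I)"
  by (simp_all add: quotient_algebra_def)

lemma ring_quotient_algebra:
  assumes "ideal I A"
  shows "ring (quotient_algebra A I)"
proof -
  interpret Q: ring "A Quot I"
    by (rule ideal.quotient_is_ring[OF assms])
  show ?thesis
  proof (rule ringI)
    show "abelian_group (quotient_algebra A I)"
    proof (rule abelian_groupI)
      fix x assume "x \<in> carrier (quotient_algebra A I)"
      then show "\<exists>y\<in>carrier (quotient_algebra A I).
          y \<oplus>\<^bsub>quotient_algebra A I\<^esub> x = \<zero>\<^bsub>quotient_algebra A I\<^esub>"
        by (intro bexI[of _ "\<ominus>\<^bsub>A Quot I\<^esub> x"]) (simp_all add: Q.l_neg)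
    qed (simp_all add: Q.add.m_ac)
    show "monoid (quotient_algebra A I)"
      by (rule monoidI) (simp_all add: Q.m_assoc)
  qed (simp_all add: Q.l_distr Q.r_distr)
qed

lemma smult_presented_algebra:
  assumes "ideal (relation_ideal X R) (free_algebra X)" "p \<in> carrier (free_algebra X)"
  shows "c \<odot>\<^bsub>presented_algebra X R\<^esub> (relation_ideal X R +>\<^bsub>free_algebra X\<^esub> p) =
    relation_ideal X R +>\<^bsub>free_algebra X\<^esub> (c \<odot>\<^bsub>free_algebra X\<^esub> p)"
proof -
  interpret ideal "relation_ideal X R" "free_algebra X" by (rule assms(1))
  let ?I = "relation_ideal X R" and ?s = "Poly_Mapping.single 0 c"
  have "?I +>\<^bsub>free_algebra X\<^esub> (?s * a) = ?I +>\<^bsub>free_algebra X\<^esub> (?s * p)"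
    if a: "a \<in> ?I +>\<^bsub>free_algebra X\<^esub> p" for a
  proof -
    obtain i where i: "i \<in> ?I" "a = i + p"
      using a by (auto simp: a_r_coset_def')
    have "?s * i \<in> ?I"
      using I_l_closed[OF i(1), of ?s] by simp
    then have "?s * a \<in> ?I +>\<^bsub>free_algebra X\<^esub> (?s * p)"
      by (auto simp: a_r_coset_def' i(2) distrib_left)
    from a_repr_independence'[OF this] show ?thesis
      using assms(2) by simp
  qed
  moreover have "p \<in> ?I +>\<^bsub>free_algebra X\<^esub> p"
    using a_rcos_self[OF assms(2)] .
  ultimately have "(\<Union>a\<in>?I +>\<^bsub>free_algebra X\<^esub> p. ?I +>\<^bsub>free_algebra X\<^esub> (?s * a)) =
      ?I +>\<^bsub>free_algebra X\<^esub> (?s * p)"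
    by blast
  then show ?thesis
    by (simp add: presented_algebra_def quotient_algebra_def)
qed

lemma ideal_relation_ideal:
  assumes "{l - r | l r. (l, r) \<in> R} \<subseteq> carrier (free_algebra X)"
  shows "ideal (relation_ideal X R) (free_algebra X)"
  unfolding relation_ideal_def by (rule ring.genideal_ideal[OF ring_free_algebra assms])


section \<open>The periplectic Brauer algebra\<close>

datatype pgen = SGen nat | EGen nat

definition pgens :: "nat \<Rightarrow> pgen set" where
  "pgens n = SGen ` {1..<n} \<union> EGen ` {1..<n}"

abbreviation sf :: "nat \<Rightarrow> pgen fpoly" where "sf i \<equiv> letter (SGen i)"
abbreviation ef :: "nat \<Rightarrow> pgen fpoly" where "ef i \<equiv> letter (EGen i)"

text \<open>A pair \<open>(l, r)\<close> stands for the relation \<open>l = r\<close>. The side conditions say that all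
  indices that occur lie in \<open>{1, ..., n - 1}\<close>.\<close>

inductive_set periplectic_relations :: "nat \<Rightarrow> (pgen fpoly \<times> pgen fpoly) set" for n where
  ss: "\<lbrakk>1 \<le> i; i < n\<rbrakk> \<Longrightarrow> (sf i * sf i, 1) \<in> periplectic_relations n"
| s_s: "\<lbrakk>1 \<le> i; i < n; 1 \<le> j; j < n; \<bar>int i - int j\<bar> > 1\<rbrakk>
    \<Longrightarrow> (sf i * sf j, sf j * sf i) \<in> periplectic_relations n"
| s_e: "\<lbrakk>1 \<le> i; i < n; 1 \<le> j; j < n; \<bar>int i - int j\<bar> > 1\<rbrakk>
    \<Longrightarrow> (sf i * ef j, ef j * sf i) \<in> periplectic_relations n"
| e_e: "\<lbrakk>1 \<le> i; i < n; 1 \<le> j; j < n; \<bar>int i - int j\<bar> > 1\<rbrakk>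
    \<Longrightarrow> (ef i * ef j, ef j * ef i) \<in> periplectic_relations n"
| braid: "\<lbrakk>1 \<le> i; i + 1 < n\<rbrakk>
    \<Longrightarrow> (sf i * sf (i+1) * sf i, sf (i+1) * sf i * sf (i+1)) \<in> periplectic_relations n"
| eee_up: "\<lbrakk>1 \<le> i; i + 1 < n\<rbrakk>
    \<Longrightarrow> (ef (i+1) * ef i * ef (i+1), - ef (i+1)) \<in> periplectic_relations n"
| eee_down: "\<lbrakk>1 \<le> i; i + 1 < n\<rbrakk>
    \<Longrightarrow> (ef i * ef (i+1) * ef i, - ef i) \<in> periplectic_relations n"
| es: "\<lbrakk>1 \<le> i; i < n\<rbrakk> \<Longrightarrow> (ef i * sf i, ef i) \<in> periplectic_relations n"
| se: "\<lbrakk>1 \<le> i; i < n\<rbrakk> \<Longrightarrow> (sf i * ef i, - ef i) \<in> periplectic_relations n"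
| see_down: "\<lbrakk>1 \<le> i; i + 1 < n\<rbrakk>
    \<Longrightarrow> (sf i * ef (i+1) * ef i, sf (i+1) * ef i) \<in> periplectic_relations n"
| see_up: "\<lbrakk>1 \<le> i; i + 1 < n\<rbrakk>
    \<Longrightarrow> (sf (i+1) * ef i * ef (i+1), - (sf i * ef (i+1))) \<in> periplectic_relations n"
| ees_up: "\<lbrakk>1 \<le> i; i + 1 < n\<rbrakk>
    \<Longrightarrow> (ef (i+1) * ef i * sf (i+1), ef (i+1) * sf i) \<in> periplectic_relations n"
| ees_down: "\<lbrakk>1 \<le> i; i + 1 < n\<rbrakk>
    \<Longrightarrow> (ef i * ef (i+1) * sf i, - (ef i * sf (i+1))) \<in> periplectic_relations n"
| ee: "\<lbrakk>1 \<le> i; i < n\<rbrakk> \<Longrightarrow> (ef i * ef i, 0) \<in> periplectic_relations n"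

definition periplectic_Brauer :: "nat \<Rightarrow> (complex, pgen fpoly set) module" where
  "periplectic_Brauer n = presented_algebra (pgens n) (periplectic_relations n)"

definition periplectic_class :: "nat \<Rightarrow> pgen fpoly \<Rightarrow> pgen fpoly set" where
  "periplectic_class n p =
     relation_ideal (pgens n) (periplectic_relations n) +>\<^bsub>free_algebra (pgens n)\<^esub> p"

definition gen_s :: "nat \<Rightarrow> nat \<Rightarrow> pgen fpoly set" where
  "gen_s n i = periplectic_class n (sf i)"

definition gen_e :: "nat \<Rightarrow> nat \<Rightarrow> pgen fpoly set" where
  "gen_e n i = periplectic_class n (ef i)"

text \<open>Indices start at \<open>1\<close>; the value at index \<open>0\<close> is a dummy.\<close>

fun jucys_murphy :: "nat \<Rightarrow> nat \<Rightarrow> pgen fpoly set" where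
  "jucys_murphy n 0 = \<zero>\<^bsub>periplectic_Brauer n\<^esub>"
| "jucys_murphy n (Suc 0) = \<zero>\<^bsub>periplectic_Brauer n\<^esub>"
| "jucys_murphy n (Suc (Suc k)) =
     (gen_s n (Suc k) \<otimes>\<^bsub>periplectic_Brauer n\<^esub> jucys_murphy n (Suc k)
        \<otimes>\<^bsub>periplectic_Brauer n\<^esub> gen_s n (Suc k))
     \<oplus>\<^bsub>periplectic_Brauer n\<^esub> gen_s n (Suc k) \<oplus>\<^bsub>periplectic_Brauer n\<^esub> gen_e n (Suc k)"

lemma periplectic_relators_closed:
  "{l - r | l r. (l, r) \<in> periplectic_relations n} \<subseteq> carrier (free_algebra (pgens n))"
proof -
  have "l \<in> carrier (free_algebra (pgens n)) \<and> r \<in> carrier (free_algebra (pgens n))"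
    if "(l, r) \<in> periplectic_relations n" for l r
    using that by cases (simp_all add: pgens_def)
  then show ?thesis by auto
qed

lemmas ideal_periplectic = ideal_relation_ideal[OF periplectic_relators_closed]

lemma ring_periplectic_Brauer: "ring (periplectic_Brauer n)"
  unfolding periplectic_Brauer_def presented_algebra_def
  by (rule ring_quotient_algebra[OF ideal_periplectic])

lemma periplectic_relations_hold:
  assumes "(l, r) \<in> periplectic_relations n"
  shows "periplectic_class n l = periplectic_class n r"
proof -
  interpret ideal "relation_ideal (pgens n) (periplectic_relations n)" "free_algebra (pgens n)"
    by (rule ideal_periplectic)
  have carr: "l \<in> carrier (free_algebra (pgens n))" "r \<in> carrier (free_algebra (pgens n))"
    using assms by (cases, simp_all add: pgens_def)+
  have "l - r \<in> relation_ideal (pgens n) (periplectic_relations n)"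
    using assms ring.genideal_self[OF ring_free_algebra periplectic_relators_closed]
    unfolding relation_ideal_def by blast
  then have "l \<in> periplectic_class n r"
    unfolding periplectic_class_def a_r_coset_def'
    by (auto intro!: bexI[of _ "l - r"])
  from a_repr_independence'[OF this[unfolded periplectic_class_def] carr(2)] show ?thesis
    by (simp only: periplectic_class_def)
qed


section \<open>Representations and matrices\<close>

locale algebra_representation =
  vector_space scale for scale :: "'c::field \<Rightarrow> 'v::ab_group_add \<Rightarrow> 'v" +
  fixes A :: "('c, 'a) module" and \<rho> :: "'a \<Rightarrow> 'v \<Rightarrow> 'v"
  assumes linear: "a \<in> carrier A \<Longrightarrow> Vector_Spaces.linear scale scale (\<rho> a)"
    and rho_add: "\<lbrakk>a \<in> carrier A; b \<in> carrier A\<rbrakk> \<Longrightarrow> \<rho> (a \<oplus>\<^bsub>A\<^esub> b) v = \<rho> a v + \<rho> b v"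
    and rho_mult: "\<lbrakk>a \<in> carrier A; b \<in> carrier A\<rbrakk> \<Longrightarrow> \<rho> (a \<otimes>\<^bsub>A\<^esub> b) v = \<rho> a (\<rho> b v)"
    and rho_one: "\<rho> \<one>\<^bsub>A\<^esub> v = v"
    and rho_smult: "a \<in> carrier A \<Longrightarrow> \<rho> (c \<odot>\<^bsub>A\<^esub> a) v = scale c (\<rho> a v)"

definition ordered_basis ::
    "('c::field \<Rightarrow> 'v::ab_group_add \<Rightarrow> 'v) \<Rightarrow> nat \<Rightarrow> (nat \<Rightarrow> 'v) \<Rightarrow> bool" where
  "ordered_basis scale d b \<longleftrightarrow>
     inj_on b {1..d} \<and> \<not> module.dependent scale (b ` {1..d})
     \<and> module.span scale (b ` {1..d}) = UNIV"

text \<open>Columns are images of basis vectors: \<open>f (b m)\<close> is the sum over \<open>l\<close> of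
  \<open>matrix_entry scale d b f l m\<close> times \<open>b l\<close>.\<close>

definition matrix_entry ::
    "('c::field \<Rightarrow> 'v::ab_group_add \<Rightarrow> 'v) \<Rightarrow> nat \<Rightarrow> (nat \<Rightarrow> 'v) \<Rightarrow> ('v \<Rightarrow> 'v)
      \<Rightarrow> nat \<Rightarrow> nat \<Rightarrow> 'c" where
  "matrix_entry scale d b f l m = module.representation scale (b ` {1..d}) (f (b m)) (b l)"

lemma (in vector_space) matrix_entry_column:
  assumes "ordered_basis scale d b"
  shows "f (b m) = (\<Sum>l=1..d. scale (matrix_entry scale d b f l m) (b l))"
proof -
  have "f (b m) = (\<Sum>v\<in>b ` {1..d}. scale (representation (b ` {1..d}) (f (b m)) v) v)"
    using assms by (subst sum_representation_eq) (auto simp: ordered_basis_def)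
  also have "\<dots> = (\<Sum>l=1..d. scale (matrix_entry scale d b f l m) (b l))"
    using assms by (subst sum.reindex) (auto simp: ordered_basis_def matrix_entry_def)
  finally show ?thesis .
qed

definition diagonal_wrt ::
    "('c::field \<Rightarrow> 'v::ab_group_add \<Rightarrow> 'v) \<Rightarrow> nat \<Rightarrow> (nat \<Rightarrow> 'v) \<Rightarrow> ('v \<Rightarrow> 'v) \<Rightarrow> bool" where
  "diagonal_wrt scale d b f \<longleftrightarrow>
     (\<forall>l\<in>{1..d}. \<forall>m\<in>{1..d}. l \<noteq> m \<longrightarrow> matrix_entry scale d b f l m = 0)"

definition JM_diagonal_basis ::
    "nat \<Rightarrow> (complex \<Rightarrow> 'v::ab_group_add \<Rightarrow> 'v) \<Rightarrow> (pgen fpoly set \<Rightarrow> 'v \<Rightarrow> 'v)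
      \<Rightarrow> nat \<Rightarrow> (nat \<Rightarrow> 'v) \<Rightarrow> bool" where
  "JM_diagonal_basis n scale \<rho> d b \<longleftrightarrow>
     ordered_basis scale d b \<and>
     (\<forall>j\<in>{1..n}. diagonal_wrt scale d b (\<rho> (jucys_murphy n j)))"

text \<open>Finite-dimensionality is part of the notion, since \<^const>\<open>ordered_basis\<close>
  describes finite bases only.\<close>

definition calibrated ::
    "nat \<Rightarrow> (complex \<Rightarrow> 'v::ab_group_add \<Rightarrow> 'v) \<Rightarrow> (pgen fpoly set \<Rightarrow> 'v \<Rightarrow> 'v) \<Rightarrow> bool" where
  "calibrated n scale \<rho> \<longleftrightarrow>
     algebra_representation scale (periplectic_Brauer n) \<rho> \<and>
     (\<exists>d b. JM_diagonal_basis n scale \<rho> d b)"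

end

theory Submission
  imports Defs
begin

text \<open>Write \<open>s, e, y, z\<close> for \<open>s\<^sub>i, e\<^sub>i, Y\<^sub>i, Y\<^sub>i\<^sub>+\<^sub>1\<close>. The recursion gives
  \<open>s z = y s + 1 - e\<close> and \<open>z s = s y + 1 + e\<close>, whose diagonal entries yield \<open>e\<^sub>m\<^sub>m = 0\<close> and
  \<open>s\<^sub>m\<^sub>m (z\<^sub>m - y\<^sub>m) = 1\<close>. If row \<open>m\<close> of \<open>s\<close> has a nonzero off-diagonal entry, then so has row \<open>m\<close>
  of \<open>e\<close>, and \<open>(y - z) e = e\<close> forces \<open>y\<^sub>m - z\<^sub>m = 1\<close>, hence \<open>s\<^sub>m\<^sub>m = -1\<close>. Otherwise \<open>s s = 1\<close>
  gives \<open>s\<^sub>m\<^sub>m\<^sup>2 = 1\<close>. The identity \<open>(y - z) e = e\<close> amounts to \<open>s y e = - y e\<close>, which follows by induction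
  on \<open>i\<close>.\<close>

section \<open>Matrix entries of sums, composites and diagonal maps\<close>

context vector_space
begin

context
  fixes d :: nat and b :: "nat \<Rightarrow> 'b"
  assumes basis: "ordered_basis scale d b"
begin

lemma matrix_entry_add:
  "matrix_entry scale d b (\<lambda>v. f v + g v) l m =
    matrix_entry scale d b f l m + matrix_entry scale d b g l m"
  using basis by (simp add: matrix_entry_def ordered_basis_def representation_add)

lemma matrix_entry_diff:
  "matrix_entry scale d b (\<lambda>v. f v - g v) l m =
    matrix_entry scale d b f l m - matrix_entry scale d b g l m"
  using basis by (simp add: matrix_entry_def ordered_basis_def representation_diff)

lemma matrix_entry_ident:
  assumes "l \<in> {1..d}" "m \<in> {1..d}"
  shows "matrix_entry scale d b (\<lambda>v. v) l m = (if l = m then 1 else 0)"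
  using basis assms
  by (auto simp: matrix_entry_def ordered_basis_def representation_basis dest: inj_onD)

text \<open>Linearity is asked of \<open>f\<close> because it is applied to the basis expansion of
  \<open>g (b m)\<close>, whereas \<open>g\<close> is evaluated only at a basis vector.\<close>

lemma matrix_entry_comp:
  assumes "Vector_Spaces.linear scale scale f"
  shows "matrix_entry scale d b (\<lambda>v. f (g v)) l m =
    (\<Sum>k=1..d. matrix_entry scale d b f l k * matrix_entry scale d b g k m)"
proof -
  interpret f: Vector_Spaces.linear scale scale f by (rule assms)
  have "f (g (b m)) = (\<Sum>k=1..d. scale (matrix_entry scale d b g k m) (f (b k)))"
    by (subst matrix_entry_column[OF basis, of g]) (simp add: f.sum f.scale)
  then show ?thesis
    using basis
    by (simp add: matrix_entry_def ordered_basis_def representation_sum representation_scale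
        mult.commute)
qed

lemma matrix_entry_comp_diagonal_left:
  assumes "Vector_Spaces.linear scale scale f" "diagonal_wrt scale d b f" "l \<in> {1..d}"
  shows "matrix_entry scale d b (\<lambda>v. f (g v)) l m =
    matrix_entry scale d b f l l * matrix_entry scale d b g l m"
proof -
  have "(\<Sum>k=1..d. matrix_entry scale d b f l k * matrix_entry scale d b g k m) =
      (\<Sum>k=1..d. if k = l then matrix_entry scale d b f l l * matrix_entry scale d b g l m else 0)"
    using assms by (intro sum.cong) (auto simp: diagonal_wrt_def)
  then show ?thesis
    using assms by (simp add: matrix_entry_comp)
qed

lemma matrix_entry_comp_diagonal_right:
  assumes "Vector_Spaces.linear scale scale f" "diagonal_wrt scale d b g" "m \<in> {1..d}"
  shows "matrix_entry scale d b (\<lambda>v. f (g v)) l m =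
    matrix_entry scale d b f l m * matrix_entry scale d b g m m"
proof -
  have "(\<Sum>k=1..d. matrix_entry scale d b f l k * matrix_entry scale d b g k m) =
      (\<Sum>k=1..d. if k = m then matrix_entry scale d b f l m * matrix_entry scale d b g m m else 0)"
    using assms by (intro sum.cong) (auto simp: diagonal_wrt_def)
  then show ?thesis
    using assms by (simp add: matrix_entry_comp)
qed

end

end

section \<open>The class map from the free algebra onto the periplectic Brauer algebra\<close>

lemma periplectic_class_in_carrier:
  assumes "p \<in> carrier (free_algebra (pgens n))"
  shows "periplectic_class n p \<in> carrier (periplectic_Brauer n)"
  using assms
  by (auto simp: periplectic_Brauer_def presented_algebra_def periplectic_class_def FactRing_def
      A_RCOSETS_def')

lemma periplectic_class_mult:
  assumes "p \<in> carrier (free_algebra (pgens n))" "q \<in> carrier (free_algebra (pgens n))"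
  shows "periplectic_class n (p * q) =
    periplectic_class n p \<otimes>\<^bsub>periplectic_Brauer n\<^esub> periplectic_class n q"
  using ideal.rcoset_mult_add[OF ideal_periplectic assms]
  by (simp add: periplectic_Brauer_def presented_algebra_def periplectic_class_def FactRing_def)

lemma periplectic_class_add:
  assumes "p \<in> carrier (free_algebra (pgens n))" "q \<in> carrier (free_algebra (pgens n))"
  shows "periplectic_class n (p + q) =
    periplectic_class n p \<oplus>\<^bsub>periplectic_Brauer n\<^esub> periplectic_class n q"
  using abelian_subgroup.a_rcos_sum[OF abelian_subgroupI3[OF ideal.axioms(1)[OF ideal_periplectic]
    ring.is_abelian_group[OF ring_free_algebra]] assms]
  by (simp add: periplectic_Brauer_def presented_algebra_def periplectic_class_def FactRing_def)

lemma periplectic_class_one: "periplectic_class n 1 = \<one>\<^bsub>periplectic_Brauer n\<^esub>"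
  by (simp add: periplectic_Brauer_def presented_algebra_def periplectic_class_def FactRing_def)

lemma gen_in_carrier:
  assumes "1 \<le> i" "i < n"
  shows "gen_s n i \<in> carrier (periplectic_Brauer n)"
    and "gen_e n i \<in> carrier (periplectic_Brauer n)"
  using assms
  by (auto simp: gen_s_def gen_e_def pgens_def intro!: periplectic_class_in_carrier)

lemma jucys_murphy_in_carrier:
  "j \<le> n \<Longrightarrow> jucys_murphy n j \<in> carrier (periplectic_Brauer n)"
proof (induction n j rule: jucys_murphy.induct)
  case (3 n k)
  interpret ring "periplectic_Brauer n" by (rule ring_periplectic_Brauer)
  show ?case using 3 gen_in_carrier[of "Suc k" n] by simp
qed (simp_all add: ring.ring_simprules(2) ring_periplectic_Brauer)

section \<open>Defining relations as operator identities\<close>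

locale periplectic_representation =
  algebra_representation scale "periplectic_Brauer n" \<rho>
  for scale :: "complex \<Rightarrow> 'v::ab_group_add \<Rightarrow> 'v" and n :: nat and \<rho>
begin

abbreviation s where "s i \<equiv> \<rho> (gen_s n i)"
abbreviation e where "e i \<equiv> \<rho> (gen_e n i)"
abbreviation y where "y j \<equiv> \<rho> (jucys_murphy n j)"
abbreviation op where "op p \<equiv> \<rho> (periplectic_class n p)"

lemma linear_ops:
  "\<lbrakk>1 \<le> i; i < n\<rbrakk> \<Longrightarrow> Vector_Spaces.linear scale scale (s i)"
  "\<lbrakk>1 \<le> i; i < n\<rbrakk> \<Longrightarrow> Vector_Spaces.linear scale scale (e i)"
  "j \<le> n \<Longrightarrow> Vector_Spaces.linear scale scale (y j)"
  by (simp_all add: linear gen_in_carrier jucys_murphy_in_carrier)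

lemma linear_add:
  assumes "Vector_Spaces.linear scale scale f"
  shows "f (u + v) = f u + f v"
proof -
  interpret Vector_Spaces.linear scale scale f by fact
  show ?thesis by (rule add)
qed

lemma linear_neg:
  assumes "Vector_Spaces.linear scale scale f"
  shows "f (- v) = - f v"
proof -
  interpret Vector_Spaces.linear scale scale f by fact
  show ?thesis by (rule neg)
qed

lemmas ops_add = linear_ops[THEN linear_add]
lemmas ops_neg = linear_ops[THEN linear_neg]

lemma op_letter [simp]: "op (sf i) = s i" "op (ef i) = e i"
  by (simp_all add: gen_s_def gen_e_def)

lemma op_mult:
  assumes "p \<in> carrier (free_algebra (pgens n))" "q \<in> carrier (free_algebra (pgens n))"
  shows "op (p * q) v = op p (op q v)"
  using assms by (simp add: periplectic_class_mult rho_mult periplectic_class_in_carrier)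

lemma op_add:
  assumes "p \<in> carrier (free_algebra (pgens n))" "q \<in> carrier (free_algebra (pgens n))"
  shows "op (p + q) v = op p v + op q v"
  using assms by (simp add: periplectic_class_add rho_add periplectic_class_in_carrier)

lemma op_one: "op 1 v = v"
  by (simp add: periplectic_class_one rho_one)

lemma op_zero: "op 0 v = 0"
  using op_add[of 0 0 v] by simp

lemma op_uminus:
  assumes "p \<in> carrier (free_algebra (pgens n))"
  shows "op (- p) v = - op p v"
  using op_add[OF assms free_algebra_uminus[OF assms], of v]
  by (simp add: op_zero eq_neg_iff_add_eq_0 add.commute)

lemma op_relation:
  assumes "(l, r) \<in> periplectic_relations n"
  shows "op l v = op r v"
  by (simp add: periplectic_relations_hold[OF assms])

lemmas op_simps = op_mult op_one op_zero op_uminus pgens_def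

lemma ss:
  assumes "1 \<le> i" "i < n"
  shows "s i (s i v) = v"
  using op_relation[OF periplectic_relations.ss, of i v] assms by (simp add: op_simps)

lemma es:
  assumes "1 \<le> i" "i < n"
  shows "e i (s i v) = e i v"
  using op_relation[OF periplectic_relations.es, of i v] assms by (simp add: op_simps)

lemma se:
  assumes "1 \<le> i" "i < n"
  shows "s i (e i v) = - e i v"
  using op_relation[OF periplectic_relations.se, of i v] assms by (simp add: op_simps)

lemma ee:
  assumes "1 \<le> i" "i < n"
  shows "e i (e i v) = 0"
  using op_relation[OF periplectic_relations.ee, of i v] assms by (simp add: op_simps)

lemma s_s_commute:
  assumes "1 \<le> i" "i + 1 < j" "j < n"
  shows "s j (s i v) = s i (s j v)"
  using op_relation[OF periplectic_relations.s_s, of j i v] assms by (simp add: op_simps)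

lemma s_e_commute:
  assumes "1 \<le> i" "i + 1 < j" "j < n"
  shows "s j (e i v) = e i (s j v)"
  using op_relation[OF periplectic_relations.s_e, of j i v] assms by (simp add: op_simps)

lemma braid:
  assumes "1 \<le> i" "i + 1 < n"
  shows "s i (s (i+1) (s i v)) = s (i+1) (s i (s (i+1) v))"
  using op_relation[OF periplectic_relations.braid, of i v] assms by (simp add: op_simps)

lemma see_up:
  assumes "1 \<le> i" "i + 1 < n"
  shows "s (i+1) (e i (e (i+1) v)) = - s i (e (i+1) v)"
  using op_relation[OF periplectic_relations.see_up, of i v] assms by (simp add: op_simps)

section \<open>Jucys-Murphy operators\<close>

lemma rho_zero: "\<rho> \<zero>\<^bsub>periplectic_Brauer n\<^esub> v = 0"
proof -
  interpret R: ring "periplectic_Brauer n" by (rule ring_periplectic_Brauer)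
  show ?thesis
    using rho_add[OF R.zero_closed R.zero_closed, of v] by simp
qed

lemma y_Suc:
  assumes "1 \<le> i" "i < n"
  shows "y (Suc i) v = s i (y i (s i v)) + s i v + e i v"
proof -
  interpret R: ring "periplectic_Brauer n" by (rule ring_periplectic_Brauer)
  obtain k where "i = Suc k" using assms(1) by (cases i) auto
  then show ?thesis
    using assms gen_in_carrier[of i n] jucys_murphy_in_carrier[of i n]
    by (simp add: rho_add rho_mult)
qed

text \<open>By the recursion, \<open>y j\<close> is built from \<open>s a\<close> and
  \<open>e a\<close> with \<open>a < j\<close>, and each of these indices is at distance more than 1
  from \<open>i\<close>.\<close>

lemma s_y_commute:
  assumes "1 \<le> j" "j < i" "i < n"
  shows "s i (y j v) = y j (s i v)"
  using assms
proof (induction j arbitrary: v rule: dec_induct)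
  case base
  \<comment> \<open>Here \<open>y 1\<close> is zero; additivity at \<open>0 + 0\<close> supplies
    \<open>s i 0 = 0\<close>.\<close>
  then show ?case using ops_add(1)[of i 0 0] by (simp add: rho_zero)
next
  case (step j)
  then show ?case
    using s_s_commute[of j i] by (simp add: y_Suc ops_add s_e_commute)
qed

text \<open>In the induction step \<open>see_up\<close> trades \<open>?t ?w\<close> for
  \<open>- ?s (?f ?w)\<close>. This puts \<open>?s\<close> next to \<open>?x\<close>, with which it
  commutes, and leaves \<open>?f\<close> directly behind \<open>?x\<close>, as the induction
  hypothesis requires.\<close>

lemma s_y_e:
  assumes "1 \<le> i" "i < n"
  shows "s i (y i (e i v)) = - y i (e i v)"
  using assms
proof (induction i arbitrary: v rule: dec_induct)
  case base
  then show ?case using ops_add(1)[of 1 0 0] by (simp add: rho_zero)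
next
  case (step i)
  have i: "1 \<le> i" "i + 1 < n" "i < n" "i \<le> n" "Suc i < n" using step by auto
  let ?t = "s i" and ?s = "s (Suc i)" and ?x = "y i" and ?f = "e i" and ?w = "e (Suc i) v"
  have sfe: "?s (?f ?w) = - ?t ?w"
    using see_up[OF i(1,2), of v] by simp
  have te: "?t ?w = - ?s (?f ?w)"
    using sfe by simp
  have ste: "?s (?t ?w) = - ?f ?w"
    using i by (simp add: te ops_neg ss)
  have txte: "?t (?x (?t ?w)) = - ?t (?s (?x (?f ?w)))"
    using i by (simp add: te ops_neg s_y_commute)
  \<comment> \<open>The braid relation turns \<open>?s ?t ?s\<close> into \<open>?t ?s ?t\<close>,
    so that the innermost \<open>?t\<close> meets \<open>?x (?f ?w)\<close> and the induction
    hypothesis replaces it by a sign.\<close>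
  have "?s (?t (?x (?t ?w))) = - ?s (?t (?s (?x (?f ?w))))"
    using i by (simp add: txte ops_neg)
  also have "\<dots> = - ?t (?s (?t (?x (?f ?w))))"
    using braid[OF i(1,2), of "?x (?f ?w)"] by simp
  also have "\<dots> = ?t (?s (?x (?f ?w)))"
    using i step.IH by (simp add: ops_neg)
  also have "\<dots> = - ?t (?x (?t ?w))"
    by (simp add: txte)
  \<comment> \<open>Of the three summands of \<open>y (Suc i) ?w\<close> in the recursion,
    \<open>?s\<close> negates the first and interchanges the other two, \<open>?t ?w\<close> and
    \<open>?f ?w\<close>, up to sign.\<close>
  finally show ?case
    using i by (simp add: y_Suc ops_add ste sfe)
qed

text \<open>The recursion is multiplied by \<open>s i\<close> on the left here and on the right in
  \<open>y_Suc_s\<close>. Since \<open>s i\<close> fixes \<open>e i\<close> from the right but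
  negates it from the left, \<open>e i\<close> appears with opposite signs.\<close>

lemma s_y_Suc:
  assumes "1 \<le> i" "i < n"
  shows "s i (y (Suc i) v) = y i (s i v) + v - e i v"
  using assms by (simp add: y_Suc ops_add ss se)

lemma y_Suc_s:
  assumes "1 \<le> i" "i < n"
  shows "y (Suc i) (s i v) = s i (y i v) + v + e i v"
  using assms by (simp add: y_Suc ss es)

text \<open>By \<open>se\<close> and \<open>ee\<close> the recursion reduces
  \<open>y (Suc i) (e i v)\<close> to \<open>- s i (y i (e i v)) - e i v\<close>, which
  \<open>s_y_e\<close> turns into \<open>y i (e i v) - e i v\<close>.\<close>

lemma y_diff_e:
  assumes "1 \<le> i" "i < n"
  shows "y i (e i v) - y (Suc i) (e i v) = e i v"
  using assms by (simp add: y_Suc se ee ops_neg s_y_e)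

section \<open>Diagonal entries for one generator index and one row\<close>

lemma diagonal_step:
  assumes B: "JM_diagonal_basis n scale \<rho> d b"
    and i: "1 \<le> i" "i < n" and m: "m \<in> {1..d}"
    and E: "\<And>k. k \<in> {1..d} \<Longrightarrow> k \<noteq> m \<Longrightarrow>
      matrix_entry scale d b (s i) m k \<noteq> 0 \<Longrightarrow> matrix_entry scale d b (e i) m k \<noteq> 0"
  shows "matrix_entry scale d b (s i) m m \<in> {1, -1}"
    and "matrix_entry scale d b (y (Suc i)) m m =
      matrix_entry scale d b (y i) m m + matrix_entry scale d b (s i) m m"
proof -
  let ?M = "matrix_entry scale d b"
  let ?\<sigma> = "?M (s i) m m" and ?\<eta> = "?M (y i) m m" and ?\<zeta> = "?M (y (Suc i)) m m"
  have b: "ordered_basis scale d b"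
    and D: "diagonal_wrt scale d b (y i)" "diagonal_wrt scale d b (y (Suc i))"
    using B i by (auto simp: JM_diagonal_basis_def)
  note L = linear_ops(1,2)[OF i] linear_ops(3)[of i] linear_ops(3)[of "Suc i"]
  note entries = matrix_entry_add[OF b] matrix_entry_diff[OF b] matrix_entry_ident[OF b]
    matrix_entry_comp_diagonal_left[OF b] matrix_entry_comp_diagonal_right[OF b]
  \<comment> \<open>\<open>ext\<close> makes the pointwise identity an equation of maps, whose
    \<open>(m, m)\<close> entry is taken; a diagonal factor leaves a single product of
    scalars.\<close>
  have 1: "?\<sigma> * ?\<zeta> = ?\<eta> * ?\<sigma> + 1 - ?M (e i) m m"
    using arg_cong[where f = "\<lambda>f. ?M f m m", OF ext[of "\<lambda>v. s i (y (Suc i) v)", OF s_y_Suc[OF i]]]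
      L D i m by (simp add: entries)
  have 2: "?\<zeta> * ?\<sigma> = ?\<sigma> * ?\<eta> + 1 + ?M (e i) m m"
    using arg_cong[where f = "\<lambda>f. ?M f m m", OF ext[of "\<lambda>v. y (Suc i) (s i v)", OF y_Suc_s[OF i]]]
      L D i m by (simp add: entries)
  \<comment> \<open>Scalars commute, so subtracting \<open>1\<close> from \<open>2\<close> leaves
    twice this entry equal to zero.\<close>
  have "?M (e i) m m = 0"
    using 1 2 by (simp add: algebra_simps)
  with 2 have inverse: "?\<sigma> * (?\<zeta> - ?\<eta>) = 1"
    by (simp add: algebra_simps)
  show \<sigma>: "?\<sigma> \<in> {1, -1}"
  proof (cases "\<exists>k\<in>{1..d}. k \<noteq> m \<and> ?M (s i) m k \<noteq> 0")
    case True
    then obtain k where k: "k \<in> {1..d}" "?M (e i) m k \<noteq> 0"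
      using E by blast
    \<comment> \<open>Left multiplication by a diagonal map scales row \<open>m\<close>, so any
      nonzero entry of that row of \<open>e i\<close> can be cancelled.\<close>
    have "?\<eta> * ?M (e i) m k - ?\<zeta> * ?M (e i) m k = ?M (e i) m k"
      using arg_cong[where f = "\<lambda>f. ?M f m k",
          OF ext[of "\<lambda>v. y i (e i v) - y (Suc i) (e i v)", OF y_diff_e[OF i]]] L D i m
      by (simp add: entries)
    then have "(?\<eta> - ?\<zeta> - 1) * ?M (e i) m k = 0"
      by (simp add: algebra_simps)
    with k have "?\<eta> - ?\<zeta> - 1 = 0"
      by (metis mult_eq_0_iff)
    then have "?\<zeta> - ?\<eta> = -1"
      by (simp add: algebra_simps)
    with inverse have "?\<sigma> * (-1) = 1" by metis
    then show ?thesis by (simp add: minus_equation_iff)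
  next
    case False
    \<comment> \<open>Row \<open>m\<close> of \<open>s i\<close> is concentrated on the diagonal, so
      the \<open>(m, m)\<close> entry of the square collapses to one term.\<close>
    then have "(\<Sum>k=1..d. ?M (s i) m k * ?M (s i) k m) = (\<Sum>k=1..d. if k = m then ?\<sigma> * ?\<sigma> else 0)"
      by (intro sum.cong) auto
    moreover have "(\<Sum>k=1..d. ?M (s i) m k * ?M (s i) k m) = 1"
      using arg_cong[where f = "\<lambda>f. ?M f m m", OF ext[of "\<lambda>v. s i (s i v)", OF ss[OF i]]] L m
      by (simp add: matrix_entry_comp[OF b] matrix_entry_ident[OF b])
    ultimately have "?\<sigma> * ?\<sigma> = 1"
      using m by simp
    then show ?thesis
      by (simp add: square_eq_1_iff)
  qed
  \<comment> \<open>A sign is its own inverse, so \<open>inverse\<close> identifies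
    \<open>?\<zeta> - ?\<eta>\<close> with \<open>?\<sigma>\<close>.\<close>
  show "?\<zeta> = ?\<eta> + ?\<sigma>"
    using \<sigma> inverse by (auto simp: algebra_simps)
qed

end

theorem lemma31:
  fixes n d :: nat
    and scale :: "complex \<Rightarrow> 'v::ab_group_add \<Rightarrow> 'v"
    and \<rho> :: "pgen fpoly set \<Rightarrow> 'v \<Rightarrow> 'v"
    and b :: "nat \<Rightarrow> 'v"
  defines "S \<equiv> \<lambda>i. matrix_entry scale d b (\<rho> (gen_s n i))"
    and "E \<equiv> \<lambda>i. matrix_entry scale d b (\<rho> (gen_e n i))"
    and "Y \<equiv> \<lambda>j. matrix_entry scale d b (\<rho> (jucys_murphy n j))"
  assumes "n \<ge> 2"
    and "algebra_representation scale (periplectic_Brauer n) \<rho>"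
    and "calibrated n scale \<rho>"
    and "JM_diagonal_basis n scale \<rho> d b"
    and "\<forall>i\<in>{1..n-1}. \<forall>l\<in>{1..d}. \<forall>m\<in>{1..d}. l \<noteq> m \<longrightarrow> (E i l m \<noteq> 0 \<longleftrightarrow> S i l m \<noteq> 0)"
  shows "\<forall>j\<in>{1..n-1}. \<forall>m\<in>{1..d}.
      Y (j+1) m m = Y j m m + S j m m \<and>
      (Y (j+1) m m = Y j m m + 1 \<or> Y (j+1) m m = Y j m m - 1) \<and>
      Y (j+1) m m = (\<Sum>a=1..j. S a m m) \<and>
      (\<forall>a\<in>{1..j}. S a m m \<in> {1, -1})"
proof (intro ballI)
  fix j m assume j: "j \<in> {1..n-1}" and m: "m \<in> {1..d}"
  interpret periplectic_representation scale n \<rho>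
    using assms(5) by (simp add: periplectic_representation_def)
  have sign: "S a m m \<in> {1, -1}" and step: "Y (Suc a) m m = Y a m m + S a m m"
    if "1 \<le> a" "a < n" for a
    using diagonal_step[OF assms(7) that m] assms(8) that m
    unfolding S_def E_def Y_def by force+
  \<comment> \<open>The increments telescope. Starting at \<open>i = 0\<close> makes the base case
    the empty sum, matching the vanishing of \<open>Y 1\<close>.\<close>
  have "Y (Suc i) m m = (\<Sum>a=1..i. S a m m)" if "i < n" for i
    using that
  proof (induction i)
    case 0
    show ?case
      unfolding Y_def matrix_entry_def by (simp add: rho_zero representation_zero)
  next
    case (Suc i)
    then show ?case using step[of "Suc i"] by simp
  qed
  moreover have "j < n" "1 \<le> j" "\<forall>a\<in>{1..j}. 1 \<le> a \<and> a < n"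
    using j by auto
  ultimately show "Y (j+1) m m = Y j m m + S j m m \<and>
      (Y (j+1) m m = Y j m m + 1 \<or> Y (j+1) m m = Y j m m - 1) \<and>
      Y (j+1) m m = (\<Sum>a=1..j. S a m m) \<and> (\<forall>a\<in>{1..j}. S a m m \<in> {1, -1})"
    using sign step[of j] sign[of j] by auto
qed

end
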